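(* Let $g\ge 1$, let $C$ be a nonseparating simple closed curve in the closed orientable surface $S_{g+1}$ of genus $g+1$, and let $t_C$ be the left-handed Dehn twist about $C$. Let $n>1$ and $1\le\ell<n$ be integers, and suppose that $h\in\mathrm{Mod}(S_{g+1})$ is a side-preserving fractional power of $t_C$ of exponent $\ell/\!/n$ whose conjugacy class is given by the SP data set $D=((\ell,n),g_0,(a,b);(c_1,n_1),\dots,(c_m,n_m))$ (of genus $g$). Then $$\frac{2g+m}{2g_0+m}\le n\le \frac{4g}{4g_0+m}.$$
   Context: $\mathrm{Mod}(S)$ is the mapping class group of the closed oriented surface $S$. A fractional power of $t_C$ of exponent $\ell/\!/n$ (a formal symbol recording the pair $(\ell,n)$) is an $h\in\mathrm{Mod}(S)$ with $h^n=t_C^{\ell}$. Such an $h$ preserves the isotopy class of $C$, so one may take a representative with $h(C)=C$. It is side-exchanging if it interchanges the two sides of $C$, and side-preserving otherwise. An SP data set of exponent $\ell/\!/n$ is a tuple $((\ell,n),g_0,(a,b);(c_1,n_1),\dots,(c_m,n_m))$ where: (i) $\ell,n,g_0$ and the $n_i$ are integers with $n>1$, $g_0\ge 0$, each $n_i>1$, and each $n_i$ divides $n$; (ii) $a$ and $b$ are residues modulo $n$ with $\gcd(a,n)=\gcd(b,n)=1$, and each $c_i$ is a residue modulo $n_i$ with $\gcd(c_i,n_i)=1$; (iii) $a+b\equiv \ell ab \pmod n$; (iv) $a+b+\sum_{i=1}^m \frac{n}{n_i}c_i\equiv 0 \pmod n$. Its genus is $g=g_0n+\frac12\sum_{i=1}^m\frac{n}{n_i}(n_i-1)$.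 Two SP data sets are considered the same if they differ by interchanging $a$ and $b$ or by reordering the pairs $(c_i,n_i)$. The data set (of genus $g$) giving the conjugacy class of $h$: remove an invariant open annular neighborhood of $C$ and cap off the two resulting boundary circles with disks with centers $P,Q$, obtaining $S_g$; $h$ induces a generator $t$ of a $C_n$-action on $S_g$ fixing $P$ and $Q$. The quotient orbifold has genus $g_0$, two cone points of order $n$ (the images of $P,Q$) and $m$ other cone points of orders $n_1,\dots,n_m$. The residue $a$ (resp. $b$) is the inverse modulo $n$ of $k$, where $2\pi k/n$ is the rotation angle of $t$ at $P$ (resp. $Q$), and $c_i$ is the inverse modulo $n_i$ of $c_i'$, where $2\pi c_i'/n_i$ is the rotation angle of $t^{n/n_i}$ at the points over the $i$-th other cone point. *)

theory Defs
  imports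
    "HOL-Complex_Analysis.Complex_Analysis"
    "HOL-Algebra.Group"
    "HOL-Number_Theory.Cong"
begin

section \<open>Oriented surfaces\<close>

text \<open>
  An oriented surface is a topological space with an atlas of complex-valued charts whose
  transition maps preserve orientation.  All maps and isotopies are topological.

  For an injective continuous \<open>f\<close> on an open subset of the plane, preserving orientation
  means having local degree one: small positively oriented circles about \<open>z\<close> go to curves
  of winding number one about \<open>f z\<close>.
\<close>

definition plane_orientation_preserving :: "complex set \<Rightarrow> (complex \<Rightarrow> complex) \<Rightarrow> bool" where
  "plane_orientation_preserving W f \<longleftrightarrow>
     (\<forall>z r. 0 < r \<and> cball z r \<subseteq> W \<longrightarrow> winding_number (f \<circ> circlepath z r) (f z) = 1)"

definition chart :: "'a topology \<Rightarrow> 'a set \<Rightarrow> ('a \<Rightarrow> complex) \<Rightarrow> bool" where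
  "chart X U \<phi> \<longleftrightarrow> openin X U \<and> open (\<phi> ` U) \<and>
     homeomorphic_map (subtopology X U) (top_of_set (\<phi> ` U)) \<phi>"

record 'a surf =
  surf_top :: "'a topology"
  surf_atlas :: "('a set \<times> ('a \<Rightarrow> complex)) set"

text \<open>Charts, not necessarily in the atlas, that are compatible with the orientation.\<close>

definition positive_chart :: "'a surf \<Rightarrow> 'a set \<Rightarrow> ('a \<Rightarrow> complex) \<Rightarrow> bool" where
  "positive_chart S U \<phi> \<longleftrightarrow> chart (surf_top S) U \<phi> \<and>
     (\<forall>(V, \<psi>) \<in> surf_atlas S.
        plane_orientation_preserving (\<phi> ` (U \<inter> V)) (\<psi> \<circ> inv_into U \<phi>))"

definition closed_oriented_surface :: "'a surf \<Rightarrow> bool" where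
  "closed_oriented_surface S \<longleftrightarrow>
     topspace (surf_top S) \<noteq> {} \<and> compact_space (surf_top S) \<and>
     Hausdorff_space (surf_top S) \<and> connected_space (surf_top S) \<and>
     (\<Union>(U, \<phi>) \<in> surf_atlas S. U) = topspace (surf_top S) \<and>
     (\<forall>(U, \<phi>) \<in> surf_atlas S. positive_chart S U \<phi>)"

text \<open>Orientation preservation, on an open set \<open>W\<close>, of an open embedding \<open>f\<close> of \<open>W\<close> into \<open>T\<close>.\<close>

definition orientation_preserving_on :: "'a surf \<Rightarrow> 'b surf \<Rightarrow> 'a set \<Rightarrow> ('a \<Rightarrow> 'b) \<Rightarrow> bool" where
  "orientation_preserving_on S T W f \<longleftrightarrow>
     (\<forall>(U, \<phi>) \<in> surf_atlas S. \<forall>(V, \<psi>) \<in> surf_atlas T.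
        plane_orientation_preserving (\<phi> ` {x \<in> U \<inter> W. f x \<in> V}) (\<psi> \<circ> f \<circ> inv_into U \<phi>))"

definition simple_closed_curve :: "'a topology \<Rightarrow> 'a set \<Rightarrow> bool" where
  "simple_closed_curve X C \<longleftrightarrow> C \<subseteq> topspace X \<and>
     subtopology X C homeomorphic_space top_of_set (sphere (0::complex) 1)"

definition nonseparating :: "'a topology \<Rightarrow> 'a set \<Rightarrow> bool" where
  "nonseparating X C \<longleftrightarrow> connectedin X (topspace X - C)"

text \<open>
  The genus of a closed orientable surface: the maximal number of disjoint simple closed
  curves along which it can be cut without becoming disconnected.
\<close>

definition cut_system :: "'a topology \<Rightarrow> 'a set set \<Rightarrow> bool" where
  "cut_system X F \<longleftrightarrow> finite F \<and> (\<forall>C \<in> F. simple_closed_curve X C) \<and>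
     pairwise disjnt F \<and> connectedin X (topspace X - \<Union>F)"

definition has_genus :: "'a topology \<Rightarrow> nat \<Rightarrow> bool" where
  "has_genus X g \<longleftrightarrow> (\<exists>F. cut_system X F \<and> card F = g) \<and> (\<forall>F. cut_system X F \<longrightarrow> card F \<le> g)"


section \<open>The mapping class group\<close>

text \<open>
  A mapping class is an isotopy class of orientation-preserving self-homeomorphisms.  A map
  of type \<open>'a \<Rightarrow> 'a\<close> is arbitrary off the underlying set of the surface, and two maps
  that agree on the surface are isotopic.
\<close>

definition homeo_plus :: "'a surf \<Rightarrow> ('a \<Rightarrow> 'a) set" where
  "homeo_plus S = {f. homeomorphic_map (surf_top S) (surf_top S) f \<and>
     orientation_preserving_on S S (topspace (surf_top S)) f}"

definition isotopic :: "'a surf \<Rightarrow> ('a \<Rightarrow> 'a) \<Rightarrow> ('a \<Rightarrow> 'a) \<Rightarrow> bool" where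
  "isotopic S f g \<longleftrightarrow>
     homotopic_with (homeomorphic_map (surf_top S) (surf_top S)) (surf_top S) (surf_top S) f g"

definition mapping_class :: "'a surf \<Rightarrow> ('a \<Rightarrow> 'a) \<Rightarrow> ('a \<Rightarrow> 'a) set" where
  "mapping_class S f = {k \<in> homeo_plus S. isotopic S f k}"

definition mapping_class_group :: "'a surf \<Rightarrow> ('a \<Rightarrow> 'a) set monoid" where
  "mapping_class_group S = \<lparr>carrier = mapping_class S ` homeo_plus S,
     monoid.mult = (\<lambda>A B. \<Union>f \<in> A. \<Union>g \<in> B. mapping_class S (f \<circ> g)),
     one = mapping_class S id\<rparr>"


section \<open>Dehn twists and fractional powers\<close>

definition annular_chart :: "'a surf \<Rightarrow> 'a set \<Rightarrow> 'a set \<Rightarrow> ('a \<Rightarrow> complex) \<Rightarrow> bool" where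
  "annular_chart S C U \<phi> \<longleftrightarrow> positive_chart S U \<phi> \<and>
     \<phi> ` U = {z. 1/2 < cmod z \<and> cmod z < 5/2} \<and> C = {x \<in> U. cmod (\<phi> x) = 3/2}"

text \<open>
  In polar coordinates this is \<open>(\<theta>, r) \<mapsto> (\<theta> + 2\<pi>(r - 1), r)\<close>.  An arc entering the
  annulus from either side is turned to the left, so the twist is left-handed.
\<close>

definition annulus_twist :: "complex \<Rightarrow> complex" where
  "annulus_twist z =
     (if 1 \<le> cmod z \<and> cmod z \<le> 2 then z * cis (2 * pi * (cmod z - 1)) else z)"

definition dehn_twist_map :: "'a surf \<Rightarrow> 'a set \<Rightarrow> ('a \<Rightarrow> 'a) \<Rightarrow> bool" where
  "dehn_twist_map S C T \<longleftrightarrow> (\<exists>U \<phi>. annular_chart S C U \<phi> \<and>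
     (\<forall>x \<in> U. T x \<in> U \<and> \<phi> (T x) = annulus_twist (\<phi> x)) \<and>
     (\<forall>x \<in> topspace (surf_top S) - U. T x = x))"

text \<open>
  All twist maps about \<open>C\<close> are isotopic, so the union below is a single mapping class,
  the class of the left-handed Dehn twist about \<open>C\<close>.
\<close>

definition dehn_twist :: "'a surf \<Rightarrow> 'a set \<Rightarrow> ('a \<Rightarrow> 'a) set" where
  "dehn_twist S C = (\<Union>T \<in> {T. dehn_twist_map S C T}. mapping_class S T)"

definition fractional_power ::
  "'a surf \<Rightarrow> 'a set \<Rightarrow> int \<Rightarrow> int \<Rightarrow> ('a \<Rightarrow> 'a) set \<Rightarrow> bool" where
  "fractional_power S C l n h \<longleftrightarrow> h \<in> carrier (mapping_class_group S) \<and>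
     h [^]\<^bsub>mapping_class_group S\<^esub> n = dehn_twist S C [^]\<^bsub>mapping_class_group S\<^esub> l"

text \<open>
  The two sides of \<open>C\<close> are represented by the parts of radius below and above \<open>3/2\<close> of an
  annular neighbourhood.
\<close>

definition exchanges_sides :: "'a surf \<Rightarrow> 'a set \<Rightarrow> ('a \<Rightarrow> 'a) \<Rightarrow> bool" where
  "exchanges_sides S C H \<longleftrightarrow> (\<exists>U \<phi> W. annular_chart S C U \<phi> \<and>
     openin (surf_top S) W \<and> C \<subseteq> W \<and> W \<subseteq> U \<and> H ` W \<subseteq> U \<and>
     (\<forall>x \<in> W. (cmod (\<phi> x) < 3/2 \<longrightarrow> 3/2 < cmod (\<phi> (H x))) \<and>
               (3/2 < cmod (\<phi> x) \<longrightarrow> cmod (\<phi> (H x)) < 3/2)))"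

definition side_preserving :: "'a surf \<Rightarrow> 'a set \<Rightarrow> ('a \<Rightarrow> 'a) set \<Rightarrow> bool" where
  "side_preserving S C h \<longleftrightarrow> (\<exists>H \<in> h. H ` C = C \<and> \<not> exchanges_sides S C H)"


section \<open>SP data sets\<close>

text \<open>
  \<open>SPData (l, n) g0 (a, b) [(c1, n1), \<dots>, (cm, nm)]\<close>.  A residue modulo \<open>k\<close> is given by its
  representative in \<open>{0..<k}\<close>.
\<close>

datatype sp_data = SPData "int \<times> int" int "int \<times> int" "(int \<times> int) list"

fun is_sp_data_set :: "sp_data \<Rightarrow> bool" where
  "is_sp_data_set (SPData (l, n) g0 (a, b) cs) \<longleftrightarrow>
     n > 1 \<and> g0 \<ge> 0 \<and> (\<forall>(c, k) \<in> set cs. k > 1 \<and> k dvd n) \<and>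
     a \<in> {0..<n} \<and> b \<in> {0..<n} \<and> coprime a n \<and> coprime b n \<and>
     (\<forall>(c, k) \<in> set cs. c \<in> {0..<k} \<and> coprime c k) \<and>
     [a + b = l * a * b] (mod n) \<and>
     [a + b + (\<Sum>(c, k) \<leftarrow> cs. (n div k) * c) = 0] (mod n)"

fun sp_genus :: "sp_data \<Rightarrow> real" where
  "sp_genus (SPData (l, n) g0 (a, b) cs) =
     of_int g0 * of_int n + 1/2 * (\<Sum>(c, k) \<leftarrow> cs. of_int n / of_int k * (of_int k - 1))"


section \<open>The data set of a fractional power\<close>

text \<open>\<open>f\<close> is a rotation by \<open>2\<pi>k/n\<close> in a suitable oriented disk about its fixed point \<open>P\<close>.\<close>

definition rotates_at :: "'a surf \<Rightarrow> ('a \<Rightarrow> 'a) \<Rightarrow> 'a \<Rightarrow> int \<Rightarrow> int \<Rightarrow> bool" where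
  "rotates_at S f P k n \<longleftrightarrow> (\<exists>V \<psi>. positive_chart S V \<psi> \<and> P \<in> V \<and> \<psi> P = 0 \<and>
     (\<forall>x \<in> V. f x \<in> V \<and> \<psi> (f x) = cis (2 * pi * of_int k / of_int n) * \<psi> x))"

definition open_disk_about :: "'a surf \<Rightarrow> 'a \<Rightarrow> 'a set \<Rightarrow> bool" where
  "open_disk_about S P E \<longleftrightarrow> (\<exists>V \<psi>. positive_chart S V \<psi> \<and> \<psi> ` V = ball 0 2 \<and>
     P \<in> V \<and> \<psi> P = 0 \<and> E = {x \<in> V. cmod (\<psi> x) < 1})"

text \<open>
  \<open>S'\<close>, with \<open>t\<close>, \<open>P\<close>, \<open>Q\<close>, is obtained from \<open>S\<close> and a homeomorphism \<open>H\<close> by removing an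
  \<open>H\<close>-invariant open annular neighbourhood \<open>A\<close> of \<open>C\<close> and capping off the two boundary circles
  of \<open>S - A\<close> with disks with centers \<open>P\<close> and \<open>Q\<close>.  Here \<open>\<iota>\<close> is the inclusion of \<open>S - A\<close> into
  \<open>S'\<close>, and \<open>t\<close> is the extension of \<open>H\<close> over the disks.
\<close>

definition capped_off ::
  "'a surf \<Rightarrow> 'a set \<Rightarrow> ('a \<Rightarrow> 'a) \<Rightarrow> 'a surf \<Rightarrow> ('a \<Rightarrow> 'a) \<Rightarrow> 'a \<Rightarrow> 'a \<Rightarrow> bool" where
  "capped_off S C H S' t P Q \<longleftrightarrow>
     closed_oriented_surface S' \<and> t \<in> homeo_plus S' \<and> t P = P \<and> t Q = Q \<and>
     (\<exists>U \<phi> A \<iota> D E. annular_chart S C U \<phi> \<and> A = {x \<in> U. 1 < cmod (\<phi> x) \<and> cmod (\<phi> x) < 2} \<and>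
        H ` A = A \<and>
        embedding_map (subtopology (surf_top S) (topspace (surf_top S) - A)) (surf_top S') \<iota> \<and>
        orientation_preserving_on S S' (topspace (surf_top S) - surf_top S closure_of A) \<iota> \<and>
        open_disk_about S' P D \<and> open_disk_about S' Q E \<and> D \<inter> E = {} \<and>
        \<iota> ` (topspace (surf_top S) - A) = topspace (surf_top S') - (D \<union> E) \<and>
        (\<forall>x \<in> topspace (surf_top S) - A. t (\<iota> x) = \<iota> (H x)))"

text \<open>\<open>t\<close> generates an effective action of the cyclic group of order \<open>n\<close>.\<close>

definition generates_cyclic_action :: "'a surf \<Rightarrow> ('a \<Rightarrow> 'a) \<Rightarrow> nat \<Rightarrow> bool" where
  "generates_cyclic_action S t n \<longleftrightarrow>
     (\<forall>x \<in> topspace (surf_top S). (t ^^ n) x = x) \<and>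
     (\<forall>j. 0 < j \<and> j < n \<longrightarrow> (\<exists>x \<in> topspace (surf_top S). (t ^^ j) x \<noteq> x))"

definition orbit_of :: "('a \<Rightarrow> 'a) \<Rightarrow> 'a \<Rightarrow> 'a set" where
  "orbit_of t x = {(t ^^ j) x | j. True}"

definition stabilizer_order :: "('a \<Rightarrow> 'a) \<Rightarrow> nat \<Rightarrow> 'a \<Rightarrow> nat" where
  "stabilizer_order t n x = card {j. j < n \<and> (t ^^ j) x = x}"

text \<open>
  The data set read off from \<open>t\<close>, \<open>P\<close>, \<open>Q\<close>.  \<open>Y\<close> is the underlying surface of the quotient
  orbifold; its points are the orbits, so its topology is determined by the quotient map
  \<open>orbit_of t\<close>.  The list \<open>ys\<close> enumerates the cone points other than the images of \<open>P\<close> and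
  \<open>Q\<close>; \<open>k\<close> below is an inverse of \<open>a\<close>, \<open>b\<close> or \<open>c\<^sub>i\<close> modulo the order of the cone point.
\<close>

fun action_data :: "'a surf \<Rightarrow> ('a \<Rightarrow> 'a) \<Rightarrow> 'a \<Rightarrow> 'a \<Rightarrow> sp_data \<Rightarrow> bool" where
  "action_data S' t P Q (SPData (l, n) g0 (a, b) cs) \<longleftrightarrow>
     generates_cyclic_action S' t (nat n) \<and>
     (\<exists>k. rotates_at S' t P k n \<and> [a * k = 1] (mod n)) \<and>
     (\<exists>k. rotates_at S' t Q k n \<and> [b * k = 1] (mod n)) \<and>
     (\<exists>Y. quotient_map (surf_top S') Y (orbit_of t) \<and> has_genus Y (nat g0)) \<and>
     orbit_of t P \<noteq> orbit_of t Q \<and>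
     (\<exists>ys. distinct ys \<and> length ys = length cs \<and>
        set ys = orbit_of t ` {x \<in> topspace (surf_top S'). stabilizer_order t (nat n) x > 1}
                 - {orbit_of t P, orbit_of t Q} \<and>
        (\<forall>i < length cs. \<forall>x \<in> ys ! i. case cs ! i of (c, m) \<Rightarrow>
           int (stabilizer_order t (nat n) x) = m \<and>
           (\<exists>k. rotates_at S' (t ^^ nat (n div m)) x k m \<and> [c * k = 1] (mod m))))"

text \<open>
  The conjugacy class of the side-preserving fractional power \<open>h\<close> of the twist about \<open>C\<close> is
  given by \<open>D\<close>.  Letting the capped surface have the same element type as \<open>S\<close> is no
  restriction, since closed surfaces all have the cardinality of the continuum.  The relation
  is invariant under interchanging \<open>a\<close> and \<open>b\<close> (interchange \<open>P\<close> and \<open>Q\<close>) and under reordering the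
  pairs \<open>(c\<^sub>i, n\<^sub>i)\<close> (reorder \<open>ys\<close>), i.e. under the identifications made between data sets.
\<close>

definition class_given_by :: "'a surf \<Rightarrow> 'a set \<Rightarrow> ('a \<Rightarrow> 'a) set \<Rightarrow> sp_data \<Rightarrow> bool" where
  "class_given_by S C h D \<longleftrightarrow>
     (\<exists>H \<in> h. \<exists>S' t P Q. H ` C = C \<and> capped_off S C H S' t P Q \<and> action_data S' t P Q D)"

end

theory Submission
  imports Defs
begin

text \<open>
  The genus formula reads \<open>2 g = n (2 g\<^sub>0 + m) - (\<Sum>i. n / n\<^sub>i)\<close>.  The lower bound for \<open>n\<close>
  expresses \<open>n\<^sub>i \<le> n\<close>, the upper bound \<open>2 \<le> n\<^sub>i\<close>.
\<close>

lemma cone_sum_bounds: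
  fixes n :: int and cs :: "(int \<times> int) list"
  assumes "n > 0" and "\<forall>(c, k) \<in> set cs. k > 1 \<and> k dvd n"
  defines "s \<equiv> (\<Sum>(c, k) \<leftarrow> cs. of_int n / of_int k * (of_int k - 1) :: real)"
  shows "s \<le> (of_int n - 1) * real (length cs)" and "of_int n * real (length cs) \<le> 2 * s"
proof -
  define f :: "int \<times> int \<Rightarrow> real"
    where "f = (\<lambda>(c, k). of_int n / of_int k * (of_int k - 1))"
  \<comment> \<open>Each summand is \<open>n - n/k\<close>, and \<open>2 \<le> k \<le> n\<close>
    puts \<open>n/k\<close> between \<open>1\<close> and \<open>n/2\<close>; the bound
    \<open>k \<le> n\<close> comes from divisibility.\<close>
  have f: "f p \<le> of_int n - 1 \<and> of_int n / 2 \<le> f p" if "p \<in> set cs" for p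
  proof -
    obtain c k where p: "p = (c, k)" by fastforce
    with that assms(2) have k: "k > 1" "k dvd n" by auto
    then have "k \<le> n" using assms(1) zdvd_imp_le by blast
    then have "1 \<le> of_int n / (of_int k :: real)" using k by (simp add: le_divide_eq)
    moreover have "of_int n / (of_int k :: real) \<le> of_int n / 2"
      using k assms(1) by (intro divide_left_mono) auto
    moreover have "f p = of_int n - of_int n / of_int k"
      using k p by (simp add: f_def field_simps)
    ultimately show ?thesis by simp
  qed
  have "s = sum_list (map f cs)" by (simp add: s_def f_def)
  moreover have "sum_list (map f cs) \<le> (\<Sum>p \<leftarrow> cs. of_int n - 1)"
    using f by (intro sum_list_mono) auto
  moreover have "(\<Sum>p \<leftarrow> cs. of_int n / 2) \<le> sum_list (map f cs)"
    using f by (intro sum_list_mono) auto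
  ultimately show "s \<le> (of_int n - 1) * real (length cs)"
    and "of_int n * real (length cs) \<le> 2 * s"
    by (simp_all add: sum_list_triv mult.commute)
qed

theorem corollary2p8:
  fixes S :: "'a surf" and C :: "'a set" and h :: "('a \<Rightarrow> 'a) set"
    and g :: nat and l n g0 a b :: int and cs :: "(int \<times> int) list" and m :: nat and D :: sp_data
  assumes "g \<ge> 1"
    and "closed_oriented_surface S" and "has_genus (surf_top S) (g + 1)"
    and "simple_closed_curve (surf_top S) C" and "nonseparating (surf_top S) C"
    and "n > 1" and "1 \<le> l" and "l < n"
    and "h \<in> carrier (mapping_class_group S)"
    and "fractional_power S C l n h" and "side_preserving S C h"
    and "D = SPData (l, n) g0 (a, b) cs" and "m = length cs"
    and "is_sp_data_set D" and "sp_genus D = real g"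
    and "class_given_by S C h D"
  shows "(2 * real g + real m) / (2 * of_int g0 + real m) \<le> of_int n \<and>
         of_int n \<le> 4 * real g / (4 * of_int g0 + real m)"
proof -
  define s where "s = (\<Sum>(c, k) \<leftarrow> cs. of_int n / of_int k * (of_int k - 1) :: real)"
  have data: "g0 \<ge> 0" "\<forall>(c, k) \<in> set cs. k > 1 \<and> k dvd n"
    using assms(12,14) by auto
  \<comment> \<open>This is Riemann-Hurwitz for the quotient by the cyclic action: the two cone
    points of order \<open>n\<close> cancel the constant terms.\<close>
  have genus: "real g = of_int g0 * of_int n + s / 2"
    using assms(12,15) by (simp add: s_def)
  have bounds: "s \<le> (of_int n - 1) * real m" "of_int n * real m \<le> 2 * s"
    using cone_sum_bounds[OF _ data(2)] assms(6,13) by (simp_all add: s_def)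
  \<comment> \<open>This keeps both denominators nonzero. If \<open>g0\<close> and \<open>m\<close>
    both vanished, the bounds would force \<open>s = 0\<close> and hence \<open>g = 0\<close>,
    against \<open>g \<ge> 1\<close>.\<close>
  have "g0 \<noteq> 0 \<or> m \<noteq> 0"
  proof (rule ccontr)
    assume "\<not> (g0 \<noteq> 0 \<or> m \<noteq> 0)"
    then show False using genus bounds assms(1) by simp
  qed
  then have pos: "0 < 2 * real_of_int g0 + real m" "0 < 4 * real_of_int g0 + real m"
    using data(1) by (auto simp: add_pos_nonneg add_nonneg_pos)
  \<comment> \<open>With denominators cleared and \<open>2 g = 2 g0 n + s\<close> inserted, the
    terms in \<open>g0 n\<close> cancel. What remains is \<open>s + m \<le> n m\<close> on the left
    and \<open>n m \<le> 2 s\<close> on the right, which are the two \<open>bounds\<close>.\<close>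
  show ?thesis
    unfolding pos_divide_le_eq[OF pos(1)] pos_le_divide_eq[OF pos(2)]
    using genus bounds by (simp add: algebra_simps)
qed

end
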